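(* Let $M$ be an arbitrary $d\times d$ matrix dilation, $m=|\det M|$, $c\in\frac12\mathbb Z^d$, $n\in\mathbb N$. Let masks $m_0$ and $\widetilde m_0$ be symmetric with respect to the point $c$ in the sense (b), let $m_0$ have sum rule of order $n$ (with respect to $M$), and let $\widetilde m_0$ satisfy $$D^\beta\big(1-m_0(\xi)\overline{\widetilde m_0(\xi)}\big)\Big|_{\xi=\mathbf 0}=0\qquad\forall\beta\in\Delta_n.$$ Then there exist wavelet masks $m_\nu$ and $\widetilde m_\nu$, $\nu=1,\dots,m$ (for $m_0,\widetilde m_0$), each of which is symmetric or antisymmetric with respect to some point in the sense (b), and such that the masks $\widetilde m_\nu$, $\nu=1,\dots,m$, have vanishing moments of order $n$.
   Context: A matrix dilation $M$ is an integer $d\times d$ matrix all of whose eigenvalues are bigger than 1 in modulus; $M^*$ is its conjugate (transpose). A set of digits $D(M)=\{s_0,\dots,s_{m-1}\}$ contains exactly one representative of each coset of $\mathbb Z^d/M\mathbb Z^d$. $[\alpha]=\sum_j\alpha_j$, $\Delta_n=\{\alpha\in\mathbb Z^d_+:[\alpha]<n\}$. A trigonometric polynomial is a finite sum $t(\xi)=\sum_{k\in\mathbb Z^d}h_ke^{2\pi i(k,\xi)}$, $h_k\in\mathbb C$; a mask (refinable mask) is a trigonometric polynomial equal to 1 at $\mathbf 0$. The polyphase components $\tau_k$, $k=0,\dots,m-1$, of $t$ are the unique trigonometric polynomials with $t(\xi)=\frac1{\sqrt m}\sum_{k=0}^{m-1}e^{2\pi i(s_k,\xi)}\tau_k(M^*\xi)$.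 A trigonometric polynomial $t$ is symmetric (antisymmetric) with respect to a point $c\in\frac12\mathbb Z^d$ in the sense (b) if $t(\xi)=e^{2\pi i(2c,\xi)}\overline{t(\xi)}$ (resp. $t(\xi)=-e^{2\pi i(2c,\xi)}\overline{t(\xi)}$), $\xi\in\mathbb R^d$. $t$ has sum rule of order $n$ with respect to $M$ if $D^\beta(t(M^{*-1}\xi))|_{\xi=s}=0$ for all $s\in D(M^* )\setminus\{\mathbf 0\}$, $\beta\in\Delta_n$ (where $\mathbf 0\in D(M^* )$). $t$ has vanishing moments of order $n$ if $D^\beta t(\mathbf 0)=0$ for all $\beta\in\Delta_n$. Wavelet masks: given masks $m_0,\widetilde m_0$, trigonometric polynomials $m_\nu,\widetilde m_\nu$, $\nu=1,\dots,m$, are called wavelet masks for $m_0,\widetilde m_0$ if the $(m+1)\times m$ matrices $\mathcal M=(\mu_{\nu k})$, $\widetilde{\mathcal M}=(\widetilde\mu_{\nu k})$, $\nu=0,\dots,m$, $k=0,\dots,m-1$, where $\mu_{\nu k}$, $\widetilde\mu_{\nu k}$ are the polyphase components of $m_\nu$, $\widetilde m_\nu$, satisfy $\mathcal M^T\overline{\widetilde{\mathcal M}}=I_m$ (mixed extension principle). *)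

theory Defs
  imports "HOL-Analysis.Analysis"
begin

definition real_vec :: "int ^ 'd \<Rightarrow> real ^ 'd" where
  "real_vec k = (\<chi> i. real_of_int (k $ i))"

text \<open>The frequency \<open>x\<close> is a real vector,
  so that \<open>2c\<close> with \<open>c\<close> half-integral is an admissible argument.\<close>

definition wave :: "real ^ 'd::finite \<Rightarrow> real ^ 'd \<Rightarrow> complex" where
  "wave x \<xi> = exp (2 * of_real pi * \<i> * of_real (x \<bullet> \<xi>))"

definition trig_poly :: "(real ^ 'd::finite \<Rightarrow> complex) \<Rightarrow> bool" where
  "trig_poly t \<longleftrightarrow>
     (\<exists>K (h :: int ^ 'd \<Rightarrow> complex). finite K \<and> (\<forall>\<xi>. t \<xi> = (\<Sum>k\<in>K. h k * wave (real_vec k) \<xi>)))"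

definition refinable_mask :: "(real ^ 'd::finite \<Rightarrow> complex) \<Rightarrow> bool" where
  "refinable_mask t \<longleftrightarrow> trig_poly t \<and> t 0 = 1"

definition matrix_dilation :: "int ^ 'd::finite ^ 'd \<Rightarrow> bool" where
  "matrix_dilation M \<longleftrightarrow>
     (\<forall>(z::complex) v. v \<noteq> 0 \<and> map_matrix of_int M *v v = z *s v \<longrightarrow> cmod z > 1)"

definition digit_set :: "int ^ 'd::finite ^ 'd \<Rightarrow> (int ^ 'd) set \<Rightarrow> bool" where
  "digit_set M D \<longleftrightarrow> (\<forall>x. \<exists>!s. s \<in> D \<and> x - s \<in> range ((*v) M))"

text \<open>Families indexed by \<open>0, \<dots>, m - 1\<close> with \<open>m = \<bar>det M\<bar>\<close> are functions on \<open>nat\<close> of which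
  only the values below \<open>m\<close> are relevant.\<close>

definition dilation_index :: "int ^ 'd::finite ^ 'd \<Rightarrow> nat" where
  "dilation_index M = nat \<bar>det M\<bar>"

definition digit_enumeration :: "int ^ 'd::finite ^ 'd \<Rightarrow> (nat \<Rightarrow> int ^ 'd) \<Rightarrow> bool" where
  "digit_enumeration M s \<longleftrightarrow>
     inj_on s {..<dilation_index M} \<and> digit_set M (s ` {..<dilation_index M})"

definition polyphase_components ::
  "int ^ 'd::finite ^ 'd \<Rightarrow> (nat \<Rightarrow> int ^ 'd) \<Rightarrow> (real ^ 'd \<Rightarrow> complex)
     \<Rightarrow> (nat \<Rightarrow> real ^ 'd \<Rightarrow> complex) \<Rightarrow> bool" where
  "polyphase_components M s t \<tau> \<longleftrightarrow>
     (\<forall>k<dilation_index M. trig_poly (\<tau> k)) \<and>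
     (\<forall>\<xi>. t \<xi> = 1 / of_real (sqrt (real (dilation_index M))) *
        (\<Sum>k<dilation_index M.
           wave (real_vec (s k)) \<xi> * \<tau> k (transpose (map_matrix of_int M) *v \<xi>)))"

definition half_integral :: "real ^ 'd \<Rightarrow> bool" where
  "half_integral c \<longleftrightarrow> (\<forall>i. 2 * c $ i \<in> \<int>)"

definition symmetric_about :: "real ^ 'd::finite \<Rightarrow> (real ^ 'd \<Rightarrow> complex) \<Rightarrow> bool" where
  "symmetric_about c t \<longleftrightarrow> (\<forall>\<xi>. t \<xi> = wave (2 *\<^sub>R c) \<xi> * cnj (t \<xi>))"

definition antisymmetric_about :: "real ^ 'd::finite \<Rightarrow> (real ^ 'd \<Rightarrow> complex) \<Rightarrow> bool" where
  "antisymmetric_about c t \<longleftrightarrow> (\<forall>\<xi>. t \<xi> = - (wave (2 *\<^sub>R c) \<xi> * cnj (t \<xi>)))"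

definition partial :: "'d \<Rightarrow> (real ^ 'd::finite \<Rightarrow> complex) \<Rightarrow> real ^ 'd \<Rightarrow> complex" where
  "partial i f x = vector_derivative (\<lambda>u. f (x + u *\<^sub>R axis i 1)) (at 0)"

text \<open>The operator \<open>D\<^sup>\<beta>\<close>. An arbitrary finite index type carries no order, so the coordinates
  are differentiated in the order of some fixed enumeration. For smooth functions
  the choice does not matter; see \<open>mixed_partial_trig_poly\<close> below for an explicit formula.\<close>

definition mixed_partial ::
  "nat ^ 'd \<Rightarrow> (real ^ 'd::finite \<Rightarrow> complex) \<Rightarrow> real ^ 'd \<Rightarrow> complex" where
  "mixed_partial \<beta> f =
     foldr (\<lambda>i. partial i ^^ (\<beta> $ i)) (SOME is. distinct is \<and> set is = UNIV) f"

definition multi_indices_below :: "nat \<Rightarrow> (nat ^ 'd::finite) set" where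
  "multi_indices_below n = {\<beta>. (\<Sum>i\<in>UNIV. \<beta> $ i) < n}"

definition sum_rule ::
  "int ^ 'd::finite ^ 'd \<Rightarrow> (int ^ 'd) set \<Rightarrow> nat \<Rightarrow> (real ^ 'd \<Rightarrow> complex) \<Rightarrow> bool" where
  "sum_rule M D n t \<longleftrightarrow>
     (\<forall>s\<in>D - {0}. \<forall>\<beta>\<in>multi_indices_below n.
        mixed_partial \<beta> (\<lambda>\<xi>. t (matrix_inv (transpose (map_matrix of_int M)) *v \<xi>))
          (real_vec s) = 0)"

definition vanishing_moments :: "nat \<Rightarrow> (real ^ 'd::finite \<Rightarrow> complex) \<Rightarrow> bool" where
  "vanishing_moments n t \<longleftrightarrow> (\<forall>\<beta>\<in>multi_indices_below n. mixed_partial \<beta> t 0 = 0)"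

text \<open>Row \<open>0\<close> of either polyphase matrix belongs to the given mask, rows \<open>1, \<dots>, m\<close> to the
  wavelet masks. Polyphase components with respect to a digit enumeration exist and are
  unique, so it is immaterial whether \<open>\<mu>\<close> and \<open>\<mu>'\<close> are quantified existentially or universally.
  The last conjunct says, entrywise, that the transpose of the first matrix times the conjugate
  of the second one is the \<open>m \<times> m\<close> identity matrix.\<close>

definition wavelet_masks ::
  "int ^ 'd::finite ^ 'd \<Rightarrow> (nat \<Rightarrow> int ^ 'd)
     \<Rightarrow> (real ^ 'd \<Rightarrow> complex) \<Rightarrow> (real ^ 'd \<Rightarrow> complex)
     \<Rightarrow> (nat \<Rightarrow> real ^ 'd \<Rightarrow> complex) \<Rightarrow> (nat \<Rightarrow> real ^ 'd \<Rightarrow> complex) \<Rightarrow> bool" where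
  "wavelet_masks M s m\<^sub>0 m\<^sub>0' w w' \<longleftrightarrow>
     (\<forall>\<nu>\<in>{1..dilation_index M}. trig_poly (w \<nu>) \<and> trig_poly (w' \<nu>)) \<and>
     (\<exists>\<mu> \<mu>'.
        polyphase_components M s m\<^sub>0 (\<mu> 0) \<and> polyphase_components M s m\<^sub>0' (\<mu>' 0) \<and>
        (\<forall>\<nu>\<in>{1..dilation_index M}.
           polyphase_components M s (w \<nu>) (\<mu> \<nu>) \<and> polyphase_components M s (w' \<nu>) (\<mu>' \<nu>)) \<and>
        (\<forall>\<xi>. \<forall>k<dilation_index M. \<forall>l<dilation_index M.
           (\<Sum>\<nu>\<le>dilation_index M. \<mu> \<nu> k \<xi> * cnj (\<mu>' \<nu> l \<xi>)) = (if k = l then 1 else 0)))"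

lemma wave_add_axis: "wave x (\<xi> + u *\<^sub>R axis i 1) = wave x \<xi> * exp (2 * of_real pi * \<i> * of_real (x $ i) * of_real u)"
  by (simp add: wave_def inner_add_right inner_axis algebra_simps flip: exp_add)

lemma partial_wave_sum:
  "partial i (\<lambda>\<xi>. \<Sum>k\<in>K. h k * wave (x k) \<xi>) =
     (\<lambda>\<xi>. \<Sum>k\<in>K. (2 * of_real pi * \<i> * of_real (x k $ i)) * h k * wave (x k) \<xi>)"
proof
  fix \<xi> :: "real ^ 'a"
  have "((\<lambda>u. h k * wave (x k) (\<xi> + u *\<^sub>R axis i 1)) has_vector_derivative
      (2 * of_real pi * \<i> * of_real (x k $ i)) * h k * wave (x k) \<xi>) (at 0)" for k
  proof -
    define a where "a = 2 * of_real pi * \<i> * complex_of_real (x k $ i)"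
    have "((\<lambda>u::complex. h k * (wave (x k) \<xi> * exp (a * u)))
        has_field_derivative a * h k * wave (x k) \<xi>) (at (of_real 0))"
      by (auto intro!: derivative_eq_intros)
    from has_vector_derivative_real_field[OF this] show ?thesis
      by (simp add: wave_add_axis a_def)
  qed
  then have "((\<lambda>u. \<Sum>k\<in>K. h k * wave (x k) (\<xi> + u *\<^sub>R axis i 1)) has_vector_derivative
      (\<Sum>k\<in>K. (2 * of_real pi * \<i> * of_real (x k $ i)) * h k * wave (x k) \<xi>)) (at 0)"
    by (intro has_vector_derivative_sum)
  then show "partial i (\<lambda>\<xi>. \<Sum>k\<in>K. h k * wave (x k) \<xi>) \<xi> =
      (\<Sum>k\<in>K. (2 * of_real pi * \<i> * of_real (x k $ i)) * h k * wave (x k) \<xi>)"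
    unfolding partial_def by (rule vector_derivative_at)
qed

lemma partial_pow_wave_sum:
  "(partial i ^^ n) (\<lambda>\<xi>. \<Sum>k\<in>K. h k * wave (x k) \<xi>) =
     (\<lambda>\<xi>. \<Sum>k\<in>K. (2 * of_real pi * \<i> * of_real (x k $ i)) ^ n * h k * wave (x k) \<xi>)"
proof (induction n)
  case (Suc n)
  then show ?case
    using partial_wave_sum[of i "\<lambda>k. (2 * of_real pi * \<i> * of_real (x k $ i)) ^ n * h k" x K]
    by (simp add: mult.assoc)
qed simp

lemma mixed_partial_trig_poly:
  "mixed_partial \<beta> (\<lambda>\<xi>. \<Sum>k\<in>K. h k * wave (x k) \<xi>) =
     (\<lambda>\<xi>. \<Sum>k\<in>K. (\<Prod>i\<in>UNIV. (2 * of_real pi * \<i> * of_real (x k $ i)) ^ (\<beta> $ i)) * h k * wave (x k) \<xi>)"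
proof -
  define js :: "'a list" where "js = (SOME is. distinct is \<and> set is = UNIV)"
  have "\<exists>is :: 'a list. distinct is \<and> set is = UNIV"
    using finite_distinct_list[OF finite[of "UNIV :: 'a set"]] by blast
  then have js: "distinct js" "set js = UNIV"
    unfolding js_def by (metis (mono_tags, lifting) someI_ex)+
  have "distinct is \<Longrightarrow> foldr (\<lambda>i. partial i ^^ (\<beta> $ i)) is (\<lambda>\<xi>. \<Sum>k\<in>K. h k * wave (x k) \<xi>) =
      (\<lambda>\<xi>. \<Sum>k\<in>K. (\<Prod>i\<in>set is. (2 * of_real pi * \<i> * of_real (x k $ i)) ^ (\<beta> $ i)) * h k * wave (x k) \<xi>)" for "is"
  proof (induction "is")
    case (Cons j js)
    then show ?case
      using partial_pow_wave_sum[of "\<beta> $ j" j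
          "\<lambda>k. (\<Prod>i\<in>set js. (2 * of_real pi * \<i> * of_real (x k $ i)) ^ (\<beta> $ i)) * h k" x K]
      by (simp add: mult.assoc)
  qed simp
  from this[OF js(1)] show ?thesis
    by (simp add: mixed_partial_def js(2) flip: js_def)
qed

end

theory Submission
  imports Defs
begin

text \<open>
  The mixed extension principle asks for a factorization
  \<open>W\<^sup>T \<cdot> cnj W' = I - P\<^sup>T \<cdot> cnj P'\<close>, where \<open>P\<close> and \<open>P'\<close> are the polyphase rows of
  \<open>m\<^sub>0\<close> and \<open>m\<^sub>0'\<close>. The trivial solution \<open>W = I\<close> already gives vanishing moments. Write
  \<open>e\<^sub>\<nu> \<xi> = exp (2 \<pi> \<i> (s\<^sub>\<nu>, \<xi>))\<close>, and let \<open>T\<^sub>\<nu>\<close> be the part of \<open>m\<^sub>0\<close> supported on the coset of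
  the digit \<open>s\<^sub>\<nu>\<close>; then the rows of \<open>W\<close> and \<open>W'\<close> are the polyphase rows of
  \<open>B\<^sub>\<nu> = e\<^sub>\<nu> / \<surd>m\<close> and \<open>B'\<^sub>\<nu> = \<surd>m e\<^sub>\<nu> (1 / m - cnj T\<^sub>\<nu> m\<^sub>0')\<close>.

  By orthogonality of the characters of \<open>\<int>\<^sup>d / M \<int>\<^sup>d\<close>, \<open>T\<^sub>\<nu>\<close> is an average of translates of \<open>m\<^sub>0\<close> by
  the points \<open>M*\<^sup>-\<^sup>1 s\<close>, \<open>s \<in> D(M*)\<close>, with unimodular weights. The sum rule says that all these
  translates except \<open>m\<^sub>0\<close> itself vanish to order \<open>n\<close> at the origin, so \<open>T\<^sub>\<nu>\<close> agrees with
  \<open>m\<^sub>0 / m\<close> to order \<open>n\<close> (\<open>coset_part_moments\<close>). Hence \<open>B'\<^sub>\<nu>\<close> agrees with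
  \<open>e\<^sub>\<nu> (1 - cnj m\<^sub>0 m\<^sub>0') / \<surd>m\<close> to order \<open>n\<close>, and this vanishes to order \<open>n\<close> by hypothesis. Since
  the trigonometric polynomials that vanish to order \<open>n\<close> form an ideal (\<open>vanishing_moments_mult\<close>), these
  congruences can be added and multiplied.

  For the symmetry, the reflection \<open>k \<mapsto> 2c - k\<close> permutes the cosets of \<open>M \<int>\<^sup>d\<close> and induces an
  involution \<open>\<sigma>\<close> of the digits, with \<open>T\<^sub>\<nu> = exp (2 \<pi> \<i> (2c, \<cdot>)) cnj T\<^sub>\<sigma>\<^sub>\<nu>\<close>
  (\<open>coset_part_symmetric\<close>). The factor of \<open>m\<^sub>0'\<close> turns this into
  \<open>B'\<^sub>\<nu> = e\<^sub>\<nu> e\<^sub>\<sigma>\<^sub>\<nu> cnj B'\<^sub>\<sigma>\<^sub>\<nu>\<close>, and the same relation holds between \<open>B\<^sub>\<nu>\<close> and \<open>B\<^sub>\<sigma>\<^sub>\<nu>\<close>. So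
  reflection in the half-integral point \<open>(s\<^sub>\<nu> + s\<^sub>\<sigma>\<^sub>\<nu>) / 2\<close> swaps the two members of a pair, and it
  remains to mix the pairs by a unitary matrix with constant entries, which does not change
  \<open>W\<^sup>T \<cdot> cnj W'\<close>. The combination with coefficients \<open>(1 + \<i>) / 2\<close> and \<open>(1 - \<i>) / 2\<close>
  (\<open>symmetrize\<close>) treats fixed points and two-element orbits of \<open>\<sigma>\<close> alike, and all wavelet
  masks obtained with it are symmetric.
\<close>

section \<open>Waves and trigonometric polynomials\<close>

lemma wave_eq_cis: "wave x \<xi> = cis (2 * pi * (x \<bullet> \<xi>))"
  by (simp add: wave_def cis_conv_exp algebra_simps)

lemma wave_add: "wave (x + y) \<xi> = wave x \<xi> * wave y \<xi>"
  by (simp add: wave_eq_cis cis_mult inner_add_left algebra_simps)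

lemma wave_diff: "wave (x - y) \<xi> = wave x \<xi> * cnj (wave y \<xi>)"
  by (simp add: wave_eq_cis cis_cnj cis_mult inner_diff_left algebra_simps)

lemma wave_minus: "wave (- x) \<xi> = cnj (wave x \<xi>)"
  by (simp add: wave_eq_cis cis_cnj)

lemma wave_shift: "wave x (\<xi> + \<eta>) = wave x \<xi> * wave x \<eta>"
  by (simp add: wave_eq_cis cis_mult inner_add_right algebra_simps)

lemma wave_0 [simp]: "wave 0 \<xi> = 1" "wave x 0 = 1"
  by (simp_all add: wave_eq_cis)

lemma wave_mult_cnj [simp]: "wave x \<xi> * cnj (wave x \<xi>) = 1" "cnj (wave x \<xi>) * wave x \<xi> = 1"
  by (simp_all add: wave_eq_cis cis_cnj cis_mult)

lemma wave_eq_1_iff: "wave x \<xi> = 1 \<longleftrightarrow> x \<bullet> \<xi> \<in> \<int>"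
proof
  assume "wave x \<xi> = 1"
  then have "cos (2 * pi * (x \<bullet> \<xi>)) = 1"
    by (auto simp: wave_eq_cis complex_eq_iff)
  then obtain j :: int where "2 * pi * (x \<bullet> \<xi>) = of_int j * 2 * pi"
    by (auto simp: cos_one_2pi_int)
  then have "x \<bullet> \<xi> = of_int j" by simp
  then show "x \<bullet> \<xi> \<in> \<int>" by simp
next
  assume "x \<bullet> \<xi> \<in> \<int>"
  then show "wave x \<xi> = 1" by (simp add: wave_eq_cis cis_multiple_2pi)
qed

lemma real_vec_simps [simp]:
  "real_vec (k + l) = real_vec k + real_vec l"
  "real_vec (k - l) = real_vec k - real_vec l"
  "real_vec (- k) = - real_vec k"
  "real_vec 0 = 0"
  by (simp_all add: real_vec_def vec_eq_iff)

lemma real_vec_nth [simp]: "real_vec k $ i = of_int (k $ i)"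
  by (simp add: real_vec_def)

lemma real_vec_eq_iff: "real_vec k = real_vec l \<longleftrightarrow> k = l"
  by (simp add: vec_eq_iff)

lemma real_vec_mult: "real_vec (M *v k) = map_matrix of_int M *v real_vec k"
  by (simp add: vec_eq_iff matrix_vector_mult_def map_matrix_def)

lemma real_vec_inner_Ints: "real_vec k \<bullet> real_vec l \<in> \<int>"
  by (auto simp: inner_vec_def intro!: Ints_sum)

text \<open>The frequencies \<open>x k\<close> may coincide, so that sums and products need no
  bookkeeping of equal exponents.\<close>

lemma trig_polyI:
  assumes "finite K" "\<And>\<xi>. t \<xi> = (\<Sum>k\<in>K. h k * wave (real_vec (x k)) \<xi>)"
  shows "trig_poly t"
proof -
  have "t \<xi> = (\<Sum>j\<in>x ` K. (\<Sum>k\<in>{k\<in>K. x k = j}. h k) * wave (real_vec j) \<xi>)" for \<xi>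
    unfolding assms(2) sum_distrib_right
    by (subst sum.image_gen[OF assms(1), of _ x]) (auto intro!: sum.cong)
  then show ?thesis
    unfolding trig_poly_def using assms(1)
    by (intro exI[of _ "x ` K"] exI[of _ "\<lambda>j. \<Sum>k\<in>{k\<in>K. x k = j}. h k"]) auto
qed

lemma trig_polyE:
  assumes "trig_poly t"
  obtains K h where "finite K" "t = (\<lambda>\<xi>. \<Sum>k\<in>K. h k * wave (real_vec k) \<xi>)"
  using assms unfolding trig_poly_def fun_eq_iff by blast

lemma trig_poly_wave: "trig_poly (wave (real_vec k))"
  by (rule trig_polyI[where K = "{k}" and h = "\<lambda>_. 1" and x = id]) auto

lemma trig_poly_const: "trig_poly (\<lambda>_. a)"
  by (rule trig_polyI[where K = "{0}" and h = "\<lambda>_. a" and x = "\<lambda>_. 0"]) auto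

lemma trig_poly_add:
  assumes "trig_poly f" "trig_poly g"
  shows "trig_poly (\<lambda>\<xi>. f \<xi> + g \<xi>)"
proof -
  obtain K h where f: "finite K" "f = (\<lambda>\<xi>. \<Sum>k\<in>K. h k * wave (real_vec k) \<xi>)"
    using assms(1) by (rule trig_polyE)
  obtain L g' where g: "finite L" "g = (\<lambda>\<xi>. \<Sum>k\<in>L. g' k * wave (real_vec k) \<xi>)"
    using assms(2) by (rule trig_polyE)
  show ?thesis
    by (rule trig_polyI[where K = "K <+> L" and h = "case_sum h g'" and x = "case_sum id id"])
      (simp_all add: f g sum.Plus)
qed

lemma trig_poly_mult:
  assumes "trig_poly f" "trig_poly g"
  shows "trig_poly (\<lambda>\<xi>. f \<xi> * g \<xi>)"
proof -
  obtain K h where f: "finite K" "f = (\<lambda>\<xi>. \<Sum>k\<in>K. h k * wave (real_vec k) \<xi>)"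
    using assms(1) by (rule trig_polyE)
  obtain L g' where g: "finite L" "g = (\<lambda>\<xi>. \<Sum>k\<in>L. g' k * wave (real_vec k) \<xi>)"
    using assms(2) by (rule trig_polyE)
  have "f \<xi> * g \<xi> = (\<Sum>(k, l)\<in>K \<times> L. (h k * g' l) * wave (real_vec (k + l)) \<xi>)" for \<xi>
    unfolding f g sum_product sum.cartesian_product
    by (intro sum.cong) (auto simp: wave_add)
  then show ?thesis
    using f(1) g(1)
    by (intro trig_polyI[where K = "K \<times> L" and h = "\<lambda>(k, l). h k * g' l" and x = "\<lambda>(k, l). k + l"])
      (auto simp: case_prod_unfold)
qed

lemma trig_poly_cnj:
  assumes "trig_poly f"
  shows "trig_poly (\<lambda>\<xi>. cnj (f \<xi>))"
proof -
  obtain K h where f: "finite K" "f = (\<lambda>\<xi>. \<Sum>k\<in>K. h k * wave (real_vec k) \<xi>)"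
    using assms by (rule trig_polyE)
  then show ?thesis
    by (intro trig_polyI[where K = K and h = "\<lambda>k. cnj (h k)" and x = uminus])
      (auto simp: wave_minus)
qed

lemma trig_poly_diff:
  assumes "trig_poly f" "trig_poly g"
  shows "trig_poly (\<lambda>\<xi>. f \<xi> - g \<xi>)"
  using trig_poly_add[OF assms(1) trig_poly_mult[OF trig_poly_const[of "-1"] assms(2)]] by simp

lemma trig_poly_sum:
  assumes "\<And>k. k \<in> K \<Longrightarrow> trig_poly (f k)"
  shows "trig_poly (\<lambda>\<xi>. \<Sum>k\<in>K. f k \<xi>)"
  using assms
  by (induction K rule: infinite_finite_induct) (auto intro: trig_poly_const trig_poly_add)

lemma trig_poly_shift:
  assumes "trig_poly t"
  shows "trig_poly (\<lambda>\<xi>. t (\<xi> + \<eta>))"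
proof -
  obtain K h where "finite K" and t: "t = (\<lambda>\<xi>. \<Sum>k\<in>K. h k * wave (real_vec k) \<xi>)"
    using assms by (rule trig_polyE)
  show ?thesis
    by (rule trig_polyI[OF \<open>finite K\<close>, where x = id and h = "\<lambda>k. h k * wave (real_vec k) \<eta>"])
      (simp add: t wave_shift mult_ac)
qed

lemmas trig_poly_intros = trig_poly_wave trig_poly_const trig_poly_add trig_poly_mult trig_poly_cnj
  trig_poly_diff trig_poly_sum trig_poly_shift

section \<open>Moments\<close>

text \<open>Polynomial functions of degree at most \<open>n\<close>. Derivatives of a trigonometric polynomial are moments
  of its coefficients; testing them against all polynomials of bounded degree instead of
  monomials gives a condition that is invariant under affine maps.\<close>

inductive poly_le :: "nat \<Rightarrow> (real ^ 'd \<Rightarrow> real) \<Rightarrow> bool" where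
  const: "poly_le n (\<lambda>x. a)"
| add: "poly_le n p \<Longrightarrow> poly_le n q \<Longrightarrow> poly_le n (\<lambda>x. p x + q x)"
| coord: "poly_le n p \<Longrightarrow> poly_le (Suc n) (\<lambda>x. x $ i * p x)"

lemma poly_le_Suc: "poly_le n p \<Longrightarrow> poly_le (Suc n) p"
  by (induction rule: poly_le.induct) (auto intro: poly_le.intros)

lemma poly_le_mult: "poly_le m p \<Longrightarrow> poly_le n q \<Longrightarrow> poly_le (m + n) (\<lambda>x. p x * q x)"
proof (induction rule: poly_le.induct)
  case (const m a)
  have "poly_le n (\<lambda>x. a * q x)"
    using const
  proof (induction rule: poly_le.induct)
    case (coord n p i)
    then show ?case using poly_le.coord[of n "\<lambda>x. a * p x" i] by (simp add: mult_ac)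
  qed (auto simp: distrib_left intro: poly_le.intros)
  then have "poly_le (m + n) (\<lambda>x. a * q x)"
    by (induction m) (auto intro: poly_le_Suc)
  then show ?case .
next
  case (coord m p i)
  then show ?case using poly_le.coord[of "m + n" "\<lambda>x. p x * q x" i] by (simp add: mult_ac)
qed (auto simp: distrib_right intro: poly_le.intros)

lemma poly_le_sum: "(\<And>j. j \<in> J \<Longrightarrow> poly_le n (f j)) \<Longrightarrow> poly_le n (\<lambda>x. \<Sum>j\<in>J. f j x)"
  by (induction J rule: infinite_finite_induct) (auto intro: poly_le.intros)

lemma poly_le_coord: "poly_le 1 (\<lambda>x. x $ i)"
  using coord[OF const[of 0 1], of i] by simp

text \<open>Translations account for products of trigonometric polynomials, linear maps for the substitution
  of \<open>M*\<^sup>-\<^sup>1 \<xi>\<close> in the sum rule, and the reflection for complex conjugation.\<close>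

lemma poly_le_affine:
  assumes "poly_le n p"
  shows "poly_le n (\<lambda>x. p (A *v x + b))"
  using assms
proof (induction rule: poly_le.induct)
  case (coord n p i)
  have "poly_le 1 (\<lambda>x. (A *v x + b) $ i)"
    unfolding vector_add_component matrix_vector_mult_def vec_lambda_beta
    using poly_le_mult[OF const[of 0] poly_le_coord]
    by (intro poly_le.add poly_le_sum poly_le.const) auto
  from poly_le_mult[OF this coord.IH] show ?case by simp
qed (auto intro: poly_le.intros)

lemma poly_le_monomial: "poly_le (\<Sum>i\<in>UNIV. \<beta> $ i) (\<lambda>x. \<Prod>i\<in>UNIV. x $ i ^ (\<beta> $ i))"
proof -
  have power: "poly_le k (\<lambda>x. x $ i ^ k)" for k and i :: 'a
    by (induction k) (auto intro: poly_le.intros)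
  have "poly_le (\<Sum>i\<in>I. \<beta> $ i) (\<lambda>x. \<Prod>i\<in>I. x $ i ^ (\<beta> $ i))" if "finite I" for I
    using that by induction (auto intro: poly_le.intros poly_le_mult power)
  then show ?thesis by simp
qed

lemma moments_zero_iff:
  fixes x :: "'k \<Rightarrow> real ^ 'd::finite"
  shows "(\<forall>\<beta>\<in>multi_indices_below n. (\<Sum>k\<in>K. of_real (\<Prod>i\<in>UNIV. x k $ i ^ (\<beta> $ i)) * h k) = 0) \<longleftrightarrow>
    (\<forall>N<n. \<forall>p. poly_le N p \<longrightarrow> (\<Sum>k\<in>K. of_real (p (x k)) * h k) = (0 :: complex))"
    (is "?L \<longleftrightarrow> ?R")
proof
  assume L: ?L
  \<comment> \<open>The additional monomial absorbs the coordinate factors of the polynomial, one at a time.\<close>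
  have "(\<Sum>k\<in>K. of_real (p (x k)) * (of_real (\<Prod>i\<in>UNIV. x k $ i ^ (\<gamma> $ i)) * h k)) = 0"
    if "poly_le N p" "N + (\<Sum>i\<in>UNIV. \<gamma> $ i) < n" for N p and \<gamma> :: "nat ^ 'd"
    using that
  proof (induction arbitrary: \<gamma> rule: poly_le.induct)
    case (const N a)
    then have "\<gamma> \<in> multi_indices_below n" by (simp add: multi_indices_below_def)
    then show ?case using L by (simp flip: sum_distrib_left)
  next
    case (add N p q)
    then show ?case by (simp add: distrib_right sum.distrib)
  next
    case (coord N p j)
    define \<delta> where "\<delta> = (\<chi> i. \<gamma> $ i + (if i = j then 1 else 0))"
    have "(\<Sum>i\<in>UNIV. \<delta> $ i) = Suc (\<Sum>i\<in>UNIV. \<gamma> $ i)"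
      by (simp add: \<delta>_def sum.distrib)
    moreover have "(\<Prod>i\<in>UNIV. y $ i ^ (\<delta> $ i)) = y $ j * (\<Prod>i\<in>UNIV. y $ i ^ (\<gamma> $ i))" for y :: "real ^ 'd"
    proof -
      have "(\<Prod>i\<in>UNIV. y $ i ^ (\<delta> $ i)) = (\<Prod>i\<in>UNIV. y $ i ^ (\<gamma> $ i) * (if i = j then y $ i else 1))"
        by (intro prod.cong) (auto simp: \<delta>_def)
      then show ?thesis by (simp add: prod.distrib mult_ac)
    qed
    ultimately show ?case using coord.IH[of \<delta>] coord.prems by (simp add: mult_ac)
  qed
  from this[where \<gamma> = 0] show ?R by simp
next
  assume ?R
  then show ?L using poly_le_monomial by (fastforce simp: multi_indices_below_def)
qed

text \<open>The operator \<open>D\<^sup>\<beta>\<close> multiplies the coefficient of frequency \<open>x\<close> by \<open>(2 \<pi> \<i> x)\<^sup>\<beta>\<close>, and the constant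
  \<open>(2 \<pi> \<i>)\<^sup>\<beta>\<close> is nonzero.\<close>

lemma mixed_partials_zero_iff:
  fixes x :: "'k \<Rightarrow> real ^ 'd::finite"
  assumes "f = (\<lambda>\<xi>. \<Sum>k\<in>K. h k * wave (x k) \<xi>)"
  shows "(\<forall>\<beta>\<in>multi_indices_below n. mixed_partial \<beta> f \<xi> = 0) \<longleftrightarrow>
    (\<forall>N<n. \<forall>p. poly_le N p \<longrightarrow> (\<Sum>k\<in>K. of_real (p (x k)) * (h k * wave (x k) \<xi>)) = 0)"
proof -
  have "mixed_partial \<beta> f \<xi> = (\<Prod>i\<in>UNIV. (2 * of_real pi * \<i>) ^ (\<beta> $ i)) *
      (\<Sum>k\<in>K. of_real (\<Prod>i\<in>UNIV. x k $ i ^ (\<beta> $ i)) * (h k * wave (x k) \<xi>))" for \<beta>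
    unfolding assms mixed_partial_trig_poly
    by (simp add: power_mult_distrib prod.distrib sum_distrib_left mult_ac)
  then show ?thesis by (simp flip: moments_zero_iff)
qed

lemmas vanishing_moments_iff = mixed_partials_zero_iff[where \<xi> = 0, folded vanishing_moments_def, simplified]

text \<open>For a fixed frequency \<open>l\<close> of the factor \<open>g\<close>, the contribution to the moment of a
  polynomial \<open>p\<close> is a moment of \<open>f\<close> for the translated polynomial \<open>p (\<cdot> + l)\<close>. This replaces the
  Leibniz rule.\<close>

lemma vanishing_moments_mult:
  assumes "trig_poly f" "trig_poly g" "vanishing_moments n f"
  shows "vanishing_moments n (\<lambda>\<xi>. g \<xi> * f \<xi>)"
proof -
  obtain K h where finK: "finite K" and f: "f = (\<lambda>\<xi>. \<Sum>k\<in>K. h k * wave (real_vec k) \<xi>)"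
    using assms(1) by (rule trig_polyE)
  obtain L g' where finL: "finite L" and g: "g = (\<lambda>\<xi>. \<Sum>k\<in>L. g' k * wave (real_vec k) \<xi>)"
    using assms(2) by (rule trig_polyE)
  have fg: "(\<lambda>\<xi>. g \<xi> * f \<xi>) =
    (\<lambda>\<xi>. \<Sum>(l, k)\<in>L \<times> K. (g' l * h k) * wave (real_vec k + real_vec l) \<xi>)"
    unfolding f g sum_product sum.cartesian_product
    by (intro ext sum.cong) (auto simp: wave_add)
  have "(\<Sum>(l, k)\<in>L \<times> K. of_real (p (real_vec k + real_vec l)) * (g' l * h k)) = 0"
    if "N < n" "poly_le N p" for N p
  proof -
    have "(\<Sum>k\<in>K. of_real (p (real_vec k + real_vec l)) * h k) = 0" for l
      using poly_le_affine[OF that(2), of "mat 1" "real_vec l"] assms(3) that(1)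
      unfolding vanishing_moments_iff[OF f] by auto
    then have "(\<Sum>l\<in>L. g' l * (\<Sum>k\<in>K. of_real (p (real_vec k + real_vec l)) * h k)) = 0"
      by simp
    then show ?thesis
      by (simp add: sum_distrib_left sum.cartesian_product mult_ac)
  qed
  then show ?thesis
    using vanishing_moments_iff[where f = "\<lambda>\<xi>. g \<xi> * f \<xi>" and K = "L \<times> K"
        and h = "\<lambda>(l, k). g' l * h k" and x = "\<lambda>(l, k). real_vec k + real_vec l"]
    by (simp add: fg case_prod_unfold)
qed

lemma vanishing_moments_add:
  assumes "trig_poly f" "trig_poly g" "vanishing_moments n f" "vanishing_moments n g"
  shows "vanishing_moments n (\<lambda>\<xi>. f \<xi> + g \<xi>)"
proof -
  obtain K h where finK: "finite K" and f: "f = (\<lambda>\<xi>. \<Sum>k\<in>K. h k * wave (real_vec k) \<xi>)"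
    using assms(1) by (rule trig_polyE)
  obtain L g' where finL: "finite L" and g: "g = (\<lambda>\<xi>. \<Sum>k\<in>L. g' k * wave (real_vec k) \<xi>)"
    using assms(2) by (rule trig_polyE)
  have fg: "(\<lambda>\<xi>. f \<xi> + g \<xi>) =
    (\<lambda>\<xi>. \<Sum>k\<in>K <+> L. case_sum h g' k * wave (case_sum real_vec real_vec k) \<xi>)"
    by (simp add: f g sum.Plus finK finL)
  show ?thesis
    using assms(3,4) unfolding vanishing_moments_iff[OF fg] vanishing_moments_iff[OF f]
      vanishing_moments_iff[OF g]
    by (simp add: sum.Plus finK finL)
qed

lemma vanishing_moments_sum:
  assumes "\<And>k. k \<in> K \<Longrightarrow> trig_poly (f k)" "\<And>k. k \<in> K \<Longrightarrow> vanishing_moments n (f k)"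
  shows "vanishing_moments n (\<lambda>\<xi>. \<Sum>k\<in>K. f k \<xi>)"
  using assms
proof (induction K rule: infinite_finite_induct)
  case empty
  then show ?case using vanishing_moments_iff[where f = "\<lambda>_. 0" and K = "{}"] by simp
next
  case infinite
  then show ?case using vanishing_moments_iff[where f = "\<lambda>_. 0" and K = "{}"] by simp
next
  case (insert x F)
  then show ?case
    using vanishing_moments_add[of "f x" "\<lambda>\<xi>. \<Sum>k\<in>F. f k \<xi>" n] trig_poly_sum[of F f] by simp
qed

lemma vanishing_moments_cnj:
  assumes "trig_poly f" "vanishing_moments n f"
  shows "vanishing_moments n (\<lambda>\<xi>. cnj (f \<xi>))"
proof -
  obtain K h where f: "f = (\<lambda>\<xi>. \<Sum>k\<in>K. h k * wave (real_vec k) \<xi>)"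
    using assms(1) by (rule trig_polyE)
  have f': "(\<lambda>\<xi>. cnj (f \<xi>)) = (\<lambda>\<xi>. \<Sum>k\<in>K. cnj (h k) * wave (- real_vec k) \<xi>)"
    by (simp add: f wave_minus)
  have neg: "(- mat 1) *v x = - x" for x :: "real ^ 'a"
    using matrix_vector_mult_diff_rdistrib[of 0 "mat 1" x] by simp
  have "(\<Sum>k\<in>K. of_real (p (- real_vec k)) * cnj (h k)) = 0"
    if "N < n" "poly_le N p" for N p
  proof -
    have "(\<Sum>k\<in>K. of_real (p (- real_vec k)) * h k) = 0"
      using poly_le_affine[OF that(2), of "- mat 1" 0] assms(2) that(1)
      unfolding vanishing_moments_iff[OF f] by (auto simp: neg)
    from arg_cong[OF this, of cnj] show ?thesis by simp
  qed
  then show ?thesis unfolding vanishing_moments_iff[OF f'] by blast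
qed

section \<open>Duality between the cosets of a lattice and its characters\<close>

text \<open>The point \<open>M*\<^sup>-\<^sup>1 s\<close>: the characters of \<open>\<int>\<^sup>d / M \<int>\<^sup>d\<close> are the maps sending \<open>k\<close> to
  \<open>wave (real_vec k) (dual_point M s)\<close>, and \<open>s\<close> matters only modulo \<open>M* \<int>\<^sup>d\<close>.\<close>

definition dual_point :: "int ^ 'd::finite ^ 'd \<Rightarrow> int ^ 'd \<Rightarrow> real ^ 'd" where
  "dual_point M s = matrix_inv (transpose (map_matrix of_int M)) *v real_vec s"

lemma det_map_matrix_of_int: "det (map_matrix of_int M) = (of_int (det M) :: real)"
  by (simp add: det_def)

lemma matrix_inv_transpose_of_int:
  fixes M :: "int ^ 'd::finite ^ 'd"
  assumes "det M \<noteq> 0"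
  defines "A \<equiv> transpose (map_matrix of_int M) :: real ^ 'd ^ 'd"
  shows "A ** matrix_inv A = mat 1" "matrix_inv A ** A = mat 1"
    "map_matrix of_int M ** transpose (matrix_inv A) = mat 1"
proof -
  have "invertible A"
    using assms by (simp add: invertible_det_nz det_map_matrix_of_int)
  then have "A ** matrix_inv A = mat 1 \<and> matrix_inv A ** A = mat 1"
    unfolding invertible_def matrix_inv_def by (rule someI_ex)
  then show "A ** matrix_inv A = mat 1" "matrix_inv A ** A = mat 1" by auto
  then show "map_matrix of_int M ** transpose (matrix_inv A) = mat 1"
    unfolding A_def by (metis matrix_transpose_mul transpose_mat transpose_transpose)
qed

lemma transpose_mult_dual_point:
  assumes "det M \<noteq> 0"
  shows "transpose (map_matrix of_int M) *v dual_point M s = real_vec s"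
  unfolding dual_point_def
  by (simp add: matrix_vector_mul_assoc matrix_inv_transpose_of_int[OF assms]
      del: transpose_matrix_vector)

lemma inner_matrix_vector_mult: "(A *v x) \<bullet> y = x \<bullet> (transpose A *v y)" for A :: "real ^ 'n ^ 'm"
  by (metis dot_lmul_matrix transpose_transpose vector_transpose_matrix inner_commute)

lemma wave_transpose: "wave x (transpose A *v \<xi>) = wave (A *v x) \<xi>"
  by (simp add: wave_eq_cis inner_matrix_vector_mult)

lemma dual_point_add: "dual_point M (s + s') = dual_point M s + dual_point M s'"
  by (simp add: dual_point_def matrix_vector_right_distrib)

lemma dual_point_0 [simp]: "dual_point M 0 = 0"
  by (simp add: dual_point_def)

lemma character_lattice:
  assumes "det M \<noteq> 0" "k \<in> range ((*v) M)"
  shows "wave (real_vec k) (dual_point M s) = 1"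
  using assms real_vec_inner_Ints
  by (auto simp: wave_eq_1_iff real_vec_mult inner_matrix_vector_mult transpose_mult_dual_point
      simp del: transpose_matrix_vector)

lemma dual_point_lattice:
  assumes "det M \<noteq> 0"
  shows "dual_point M (transpose M *v y) = real_vec y"
proof -
  have "real_vec (transpose M *v y) = transpose (map_matrix of_int M) *v real_vec y"
    by (simp add: vec_eq_iff matrix_vector_mult_def transpose_def del: transpose_matrix_vector)
  then show ?thesis
    unfolding dual_point_def
    by (simp add: matrix_vector_mul_assoc matrix_inv_transpose_of_int[OF assms]
        del: transpose_matrix_vector)
qed

lemma character_dual_lattice:
  assumes "det M \<noteq> 0" "s - s' \<in> range ((*v) (transpose M))"
  shows "wave (real_vec k) (dual_point M s) = wave (real_vec k) (dual_point M s')"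
proof -
  obtain y where "s = s' + transpose M *v y"
    using assms(2) by (metis add_diff_cancel_left' diff_add_cancel imageE add.commute)
  then have "wave (real_vec k) (dual_point M s) =
      wave (real_vec k) (dual_point M s') * wave (real_vec k) (real_vec y)"
    by (simp add: dual_point_add wave_shift dual_point_lattice assms(1)
        del: transpose_matrix_vector)
  also have "wave (real_vec k) (real_vec y) = 1"
    by (simp add: wave_eq_1_iff real_vec_inner_Ints)
  finally show ?thesis by simp
qed

text \<open>If all characters are trivial at \<open>k\<close>, then testing with unit vectors \<open>s\<close> shows that \<open>M\<^sup>-\<^sup>1 k\<close> has
  integral entries.\<close>

lemma exists_nontrivial_character:
  assumes "det M \<noteq> 0" "k \<notin> range ((*v) M)"
  shows "\<exists>s. wave (real_vec k) (dual_point M s) \<noteq> 1"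
proof (rule ccontr)
  assume "\<not> ?thesis"
  then have int: "real_vec k \<bullet> dual_point M s \<in> \<int>" for s
    by (simp add: wave_eq_1_iff)
  define N where "N = matrix_inv (transpose (map_matrix of_int M :: real ^ 'a ^ 'a))"
  define x where "x = transpose N *v real_vec k"
  have "x $ i \<in> \<int>" for i
  proof -
    have "x $ i = x \<bullet> real_vec (axis i 1)"
      by (simp add: inner_axis inner_vec_def axis_def if_distrib cong: if_cong)
    also have "\<dots> = real_vec k \<bullet> dual_point M (axis i 1)"
      by (simp add: x_def dual_point_def inner_matrix_vector_mult N_def
          del: transpose_matrix_vector)
    finally show ?thesis using int by simp
  qed
  then have "\<forall>i. \<exists>j. x $ i = of_int j" by (auto elim: Ints_cases)
  then obtain y where "\<And>i. x $ i = of_int (y i)" by metis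
  then have x: "x = real_vec (\<chi> i. y i)"
    by (simp add: vec_eq_iff)
  have "map_matrix of_int M ** transpose N = mat 1"
    unfolding N_def by (rule matrix_inv_transpose_of_int[OF assms(1)])
  then have "map_matrix of_int M *v x = real_vec k"
    by (simp add: x_def matrix_vector_mul_assoc del: transpose_matrix_vector)
  then have "real_vec (M *v (\<chi> i. y i)) = real_vec k"
    by (simp add: x real_vec_mult)
  then have "M *v (\<chi> i. y i) = k" by (simp only: real_vec_eq_iff)
  then show False using assms(2) by blast
qed

lemma range_mult_diff:
  fixes M :: "int ^ 'n ^ 'm"
  assumes "x \<in> range ((*v) M)" "y \<in> range ((*v) M)"
  shows "x - y \<in> range ((*v) M)"
  using assms by (auto simp flip: matrix_vector_mult_diff_distrib)

lemma digit_unique: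
  assumes "digit_set M D" "s \<in> D" "s' \<in> D" "s - s' \<in> range ((*v) M)"
  shows "s = s'"
proof -
  have "s - s \<in> range ((*v) M)" by (auto intro: range_eqI[of _ _ 0])
  then show ?thesis using assms unfolding digit_set_def by blast
qed

text \<open>Cramer's rule: \<open>det M M\<^sup>-\<^sup>1 b\<close> is integral, its entries being determinants of integer matrices.\<close>

lemma det_scaled_in_lattice:
  fixes M :: "int ^ 'd::finite ^ 'd"
  assumes "det M \<noteq> 0"
  shows "det M *s b \<in> range ((*v) M)"
proof -
  define y where "y = (\<chi> k. det (\<chi> i j. if j = k then b $ i else M $ i $ j))"
  define A where "A = (map_matrix of_int M :: real ^ 'd ^ 'd)"
  have "det A \<noteq> 0" using assms by (simp add: A_def det_map_matrix_of_int)
  then have "A *v (\<chi> k. det (\<chi> i j. if j = k then real_vec b $ i else A $ i $ j) / det A) = real_vec b"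
    by (simp add: cramer)
  moreover have "(\<chi> k. det (\<chi> i j. if j = k then real_vec b $ i else A $ i $ j) / det A) =
      (1 / of_int (det M)) *s real_vec y"
  proof -
    have eq: "(\<chi> i j. if j = k then real_vec b $ i else A $ i $ j) =
       map_matrix of_int (\<chi> i j. if j = k then b $ i else M $ i $ j)" for k
      by (simp add: vec_eq_iff A_def)
    show ?thesis
      unfolding eq unfolding det_map_matrix_of_int A_def by (simp add: vec_eq_iff y_def)
  qed
  ultimately have "(1 / of_int (det M)) *s (A *v real_vec y) = real_vec b"
    by (simp add: vector_scalar_commute)
  then have "of_int (det M) *s real_vec b = A *v real_vec y"
    using assms by (auto simp: vec_eq_iff field_simps)
  then have "real_vec (det M *s b) = real_vec (M *v y)"
    by (simp add: real_vec_mult A_def vec_eq_iff)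
  then show ?thesis by (simp add: real_vec_eq_iff)
qed

text \<open>As the lattice contains \<open>det M \<int>\<^sup>d\<close>, digits that agree modulo \<open>det M\<close> in every coordinate
  are equal.\<close>

lemma finite_digit_set:
  fixes M :: "int ^ 'd::finite ^ 'd"
  assumes "digit_set M D" "det M \<noteq> 0"
  shows "finite D"
proof -
  define r where "r s = (\<lambda>i. s $ i mod \<bar>det M\<bar>)" for s :: "int ^ 'd"
  have "r ` D \<subseteq> (UNIV \<rightarrow>\<^sub>E {0..<\<bar>det M\<bar>})"
    using assms(2) by (auto simp: r_def)
  moreover have "finite ((UNIV :: 'd set) \<rightarrow>\<^sub>E {0..<\<bar>det M\<bar>})"
    by (intro finite_PiE) auto
  ultimately have "finite (r ` D)" by (rule finite_subset)
  moreover have "inj_on r D"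
  proof (rule inj_onI)
    fix s s' assume "s \<in> D" "s' \<in> D" "r s = r s'"
    then have "\<forall>i. \<exists>b. s $ i - s' $ i = det M * b"
      by (auto simp: r_def fun_eq_iff mod_eq_dvd_iff elim: dvdE)
    then obtain b where "\<And>i. s $ i - s' $ i = det M * b i" by metis
    then have "s - s' = det M *s (\<chi> i. b i)" by (simp add: vec_eq_iff)
    then have "s - s' \<in> range ((*v) M)" using det_scaled_in_lattice[OF assms(2)] by simp
    then show "s = s'" by (rule digit_unique[OF assms(1) \<open>s \<in> D\<close> \<open>s' \<in> D\<close>])
  qed
  ultimately show ?thesis by (rule finite_imageD)
qed

text \<open>Translation by a point at which the character of \<open>k\<close> is not 1 permutes the
  cosets of \<open>M* \<int>\<^sup>d\<close>, and it multiplies the sum by a number other than 1.\<close>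

lemma sum_characters:
  assumes "digit_set (transpose M) D" "det M \<noteq> 0"
  shows "(\<Sum>s\<in>D. wave (real_vec k) (dual_point M s)) = (if k \<in> range ((*v) M) then of_nat (card D) else 0)"
proof (cases "k \<in> range ((*v) M)")
  case True
  then show ?thesis using character_lattice[OF assms(2)] by simp
next
  case False
  then obtain e where e: "wave (real_vec k) (dual_point M e) \<noteq> 1"
    using exists_nontrivial_character[OF assms(2)] by blast
  have fin: "finite D" using finite_digit_set[OF assms(1)] assms(2) by simp
  have "\<forall>x. \<exists>s. s \<in> D \<and> x - s \<in> range ((*v) (transpose M))"
    using assms(1) unfolding digit_set_def by blast
  \<comment> \<open>The digit of the coset of a point.\<close>
  then obtain d where d: "\<And>x. d x \<in> D" "\<And>x. x - d x \<in> range ((*v) (transpose M))" by metis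
  have inj: "inj_on (\<lambda>s. d (s + e)) D"
  proof (rule inj_onI)
    fix s s' assume s: "s \<in> D" "s' \<in> D" "d (s + e) = d (s' + e)"
    from range_mult_diff[OF d(2)[of "s + e"] d(2)[of "s' + e"]] s(3)
    have "s - s' \<in> range ((*v) (transpose M))" by simp
    then show "s = s'" by (rule digit_unique[OF assms(1) s(1,2)])
  qed
  have "(\<lambda>s. d (s + e)) ` D = D"
    using d(1) by (intro endo_inj_surj fin inj) auto
  then have "(\<Sum>s\<in>D. wave (real_vec k) (dual_point M s)) =
      (\<Sum>s\<in>(\<lambda>s. d (s + e)) ` D. wave (real_vec k) (dual_point M s))"
    by simp
  also have "\<dots> = (\<Sum>s\<in>D. wave (real_vec k) (dual_point M (d (s + e))))"
    by (simp add: sum.reindex[OF inj])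
  also have "\<dots> = (\<Sum>s\<in>D. wave (real_vec k) (dual_point M s)) * wave (real_vec k) (dual_point M e)"
    unfolding sum_distrib_right
    using character_dual_lattice[OF assms(2) d(2)]
    by (intro sum.cong refl) (metis dual_point_add wave_shift)
  finally have "(\<Sum>s\<in>D. wave (real_vec k) (dual_point M s)) = 0"
    using e by (metis mult_cancel_left1)
  then show ?thesis using False by simp
qed

section \<open>Coset parts of a trigonometric polynomial\<close>

text \<open>The part of \<open>t\<close> with frequencies in the coset of \<open>r\<close>, see \<open>coset_part_eq\<close>. Expressing it by values of
  the function \<open>t\<close> instead of its coefficients transfers symmetries of \<open>t\<close> to its coset parts
  without uniqueness of Fourier coefficients.\<close>

definition coset_part ::
  "int ^ 'd::finite ^ 'd \<Rightarrow> (int ^ 'd) set \<Rightarrow> int ^ 'd \<Rightarrow> (real ^ 'd \<Rightarrow> complex) \<Rightarrow> real ^ 'd \<Rightarrow> complex" where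
  "coset_part M D r t \<xi> =
     1 / of_nat (card D) * (\<Sum>s\<in>D. t (\<xi> + dual_point M s) * cnj (wave (real_vec r) (dual_point M s)))"

lemma coset_part_eq:
  assumes "digit_set (transpose M) D" "det M \<noteq> 0"
    and "t = (\<lambda>\<xi>. \<Sum>k\<in>K. h k * wave (real_vec k) \<xi>)"
  shows "coset_part M D r t \<xi> =
    (\<Sum>k\<in>K. if k - r \<in> range ((*v) M) then h k * wave (real_vec k) \<xi> else 0)"
proof -
  have "finite D" "D \<noteq> {}"
    using finite_digit_set[OF assms(1)] assms(1,2) by (auto simp: digit_set_def)
  then have card: "of_nat (card D) \<noteq> (0 :: complex)" by simp
  have "(\<Sum>s\<in>D. t (\<xi> + dual_point M s) * cnj (wave (real_vec r) (dual_point M s))) =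
      (\<Sum>k\<in>K. h k * wave (real_vec k) \<xi> * (\<Sum>s\<in>D. wave (real_vec (k - r)) (dual_point M s)))"
    unfolding assms(3) sum_distrib_right sum_distrib_left
    by (subst sum.swap) (simp add: wave_shift wave_diff mult_ac)
  also have "\<dots> = of_nat (card D) *
      (\<Sum>k\<in>K. if k - r \<in> range ((*v) M) then h k * wave (real_vec k) \<xi> else 0)"
    unfolding sum_characters[OF assms(1,2)] sum_distrib_left by (intro sum.cong) auto
  finally show ?thesis
    using card by (simp add: coset_part_def)
qed

lemma trig_poly_coset_part:
  assumes "digit_set (transpose M) D" "det M \<noteq> 0" "trig_poly t"
  shows "trig_poly (coset_part M D r t)"
proof -
  obtain K h where "finite K" and t: "t = (\<lambda>\<xi>. \<Sum>k\<in>K. h k * wave (real_vec k) \<xi>)"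
    using assms(3) by (rule trig_polyE)
  show ?thesis
    by (rule trig_polyI[OF \<open>finite K\<close>, where x = id
          and h = "\<lambda>k. if k - r \<in> range ((*v) M) then h k else 0"])
      (auto simp: coset_part_eq[OF assms(1,2) t] intro!: sum.cong)
qed

lemma digit_enumeration_ex1:
  assumes "digit_enumeration M s"
  shows "\<exists>!\<nu>. \<nu> < dilation_index M \<and> k - s \<nu> \<in> range ((*v) M)"
proof -
  have "\<exists>!r. r \<in> s ` {..<dilation_index M} \<and> k - r \<in> range ((*v) M)"
    using assms unfolding digit_enumeration_def digit_set_def by blast
  then obtain \<nu> where \<nu>: "\<nu> < dilation_index M" "k - s \<nu> \<in> range ((*v) M)"
    and unique: "\<And>\<nu>'. \<nu>' < dilation_index M \<Longrightarrow> k - s \<nu>' \<in> range ((*v) M) \<Longrightarrow> s \<nu>' = s \<nu>"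
    by (metis imageE imageI lessThan_iff)
  show ?thesis
  proof (rule ex1I[of _ \<nu>])
    show "\<nu>' = \<nu>" if "\<nu>' < dilation_index M \<and> k - s \<nu>' \<in> range ((*v) M)" for \<nu>'
      using that \<nu> unique assms unfolding digit_enumeration_def inj_on_def by blast
  qed (use \<nu> in blast)
qed

lemma dilation_index_pos:
  assumes "digit_enumeration M s"
  shows "dilation_index M > 0" "det M \<noteq> 0"
proof -
  show "dilation_index M > 0"
    using digit_enumeration_ex1[OF assms, of 0] by auto
  then show "det M \<noteq> 0" by (simp add: dilation_index_def)
qed

lemma sum_coset_part:
  assumes "digit_set (transpose M) D" "digit_enumeration M s" "trig_poly t"
  shows "(\<Sum>\<nu><dilation_index M. coset_part M D (s \<nu>) t \<xi>) = t \<xi>"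
proof -
  obtain K h where "finite K" and t: "t = (\<lambda>\<xi>. \<Sum>k\<in>K. h k * wave (real_vec k) \<xi>)"
    using assms(3) by (rule trig_polyE)
  have "(\<Sum>\<nu><dilation_index M. if k - s \<nu> \<in> range ((*v) M) then a else 0) = a" for k and a :: complex
  proof -
    obtain \<nu> where "\<nu> < dilation_index M"
      and "\<And>\<nu>'. \<nu>' < dilation_index M \<Longrightarrow> k - s \<nu>' \<in> range ((*v) M) \<longleftrightarrow> \<nu>' = \<nu>"
      using digit_enumeration_ex1[OF assms(2), of k] by metis
    then have "(\<Sum>\<nu>'<dilation_index M. if k - s \<nu>' \<in> range ((*v) M) then a else 0) =
        (\<Sum>\<nu>'<dilation_index M. if \<nu>' = \<nu> then a else 0)"
      by (intro sum.cong) auto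
    then show ?thesis using \<open>\<nu> < dilation_index M\<close> by simp
  qed
  then show ?thesis
    unfolding coset_part_eq[OF assms(1) dilation_index_pos(2)[OF assms(2)] t]
    by (subst sum.swap) (simp add: t)
qed

lemma coset_part_cong:
  assumes "det M \<noteq> 0" "r - r' \<in> range ((*v) M)"
  shows "coset_part M D r t = coset_part M D r' t"
proof -
  have "wave (real_vec r) (dual_point M s) = wave (real_vec r') (dual_point M s)" for s
    using character_lattice[OF assms, of s] by (simp add: wave_diff) (metis wave_mult_cnj(2) mult.assoc mult.right_neutral mult_1)
  then show ?thesis by (simp add: coset_part_def fun_eq_iff)
qed

text \<open>The reflection \<open>k \<mapsto> 2c - k\<close> of the frequencies maps the coset of \<open>r\<close> onto that of \<open>2c - r\<close>.\<close>

lemma coset_part_symmetric: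
  assumes "symmetric_about c t" "2 *\<^sub>R c = real_vec C"
  shows "coset_part M D r t \<xi> = wave (real_vec C) \<xi> * cnj (coset_part M D (C - r) t \<xi>)"
proof -
  have "t \<eta> = wave (real_vec C) \<eta> * cnj (t \<eta>)" for \<eta>
    using assms unfolding symmetric_about_def by simp
  then have "t (\<xi> + \<eta>) * cnj (wave (real_vec r) \<eta>) =
      wave (real_vec C) \<xi> * cnj (t (\<xi> + \<eta>) * cnj (wave (real_vec (C - r)) \<eta>))" for \<eta>
    by (subst \<open>\<And>\<eta>. t \<eta> = _\<close>) (simp add: wave_shift wave_diff mult_ac)
  then show ?thesis
    by (simp add: coset_part_def sum_distrib_left mult_ac)
qed

text \<open>A frequency \<open>k\<close> in the coset of \<open>s \<nu>\<close> is \<open>s \<nu> + M y\<close> with integral \<open>y\<close>, and the wave of frequency \<open>M y\<close>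
  at \<open>\<xi>\<close> is the wave of frequency \<open>y\<close> at \<open>M* \<xi>\<close>.\<close>

lemma polyphase_components_exist:
  assumes "digit_set (transpose M) D" "digit_enumeration M s" "trig_poly t"
  obtains \<tau> where "polyphase_components M s t \<tau>"
    and "\<And>\<nu> \<xi>. \<nu> < dilation_index M \<Longrightarrow> \<tau> \<nu> (transpose (map_matrix of_int M) *v \<xi>) =
      of_real (sqrt (dilation_index M)) * (cnj (wave (real_vec (s \<nu>)) \<xi>) * coset_part M D (s \<nu>) t \<xi>)"
proof -
  define q where "q = complex_of_real (sqrt (dilation_index M))"
  have q: "q \<noteq> 0" using dilation_index_pos(1)[OF assms(2)] by (simp add: q_def)
  obtain K h where "finite K" and t: "t = (\<lambda>\<xi>. \<Sum>k\<in>K. h k * wave (real_vec k) \<xi>)"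
    using assms(3) by (rule trig_polyE)
  define y where "y k = (SOME y. M *v y = k)" for k
  have y: "M *v y k = k" if "k \<in> range ((*v) M)" for k
    using that unfolding y_def by (metis (mono_tags, lifting) imageE someI)
  define \<tau> where "\<tau> \<nu> \<xi> = (\<Sum>k\<in>K. (if k - s \<nu> \<in> range ((*v) M) then q * h k else 0) *
      wave (real_vec (y (k - s \<nu>))) \<xi>)" for \<nu> \<xi>
  have \<tau>: "\<tau> \<nu> (transpose (map_matrix of_int M) *v \<xi>) =
      q * (cnj (wave (real_vec (s \<nu>)) \<xi>) * coset_part M D (s \<nu>) t \<xi>)" for \<nu> \<xi>
  proof -
    have "wave (real_vec (y (k - s \<nu>))) (transpose (map_matrix of_int M) *v \<xi>) =
        wave (real_vec k) \<xi> * cnj (wave (real_vec (s \<nu>)) \<xi>)"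
      if "k - s \<nu> \<in> range ((*v) M)" for k
      using y[OF that]
      by (simp add: wave_transpose wave_diff flip: real_vec_mult del: transpose_matrix_vector)
    then show ?thesis
      unfolding \<tau>_def coset_part_eq[OF assms(1) dilation_index_pos(2)[OF assms(2)] t] sum_distrib_left
      by (intro sum.cong) auto
  qed
  have "trig_poly (\<tau> \<nu>)" for \<nu>
    unfolding \<tau>_def by (intro trig_poly_intros)
  moreover have "t \<xi> = 1 / q * (\<Sum>\<nu><dilation_index M.
      wave (real_vec (s \<nu>)) \<xi> * \<tau> \<nu> (transpose (map_matrix of_int M) *v \<xi>))" for \<xi>
  proof -
    have "wave (real_vec (s \<nu>)) \<xi> * \<tau> \<nu> (transpose (map_matrix of_int M) *v \<xi>) =
        q * coset_part M D (s \<nu>) t \<xi>" for \<nu>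
      unfolding \<tau> by (metis mult.assoc mult.left_commute mult_1 wave_mult_cnj(1))
    then show ?thesis
      using q by (simp add: sum_coset_part[OF assms] flip: sum_distrib_left del: transpose_matrix_vector)
  qed
  ultimately have "polyphase_components M s t \<tau>"
    unfolding polyphase_components_def q_def by blast
  with \<tau> that show thesis unfolding q_def by blast
qed

text \<open>The sum rule concerns \<open>t (M*\<^sup>-\<^sup>1 \<xi>)\<close> at \<open>s\<close>, whose frequencies are \<open>M\<^sup>-\<^sup>1 k\<close>. Testing with the polynomial
  \<open>p (M x)\<close> gives the moment of \<open>p\<close> for the translate of \<open>t\<close>.\<close>

lemma sum_rule_shift:
  assumes "sum_rule M D n t" "det M \<noteq> 0" "trig_poly t" "s \<in> D" "s \<noteq> 0"
  shows "vanishing_moments n (\<lambda>\<xi>. t (\<xi> + dual_point M s))"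
proof -
  obtain K h where "finite K" and t: "t = (\<lambda>\<xi>. \<Sum>k\<in>K. h k * wave (real_vec k) \<xi>)"
    using assms(3) by (rule trig_polyE)
  define N where "N = matrix_inv (transpose (map_matrix of_int M :: real ^ 'a ^ 'a))"
  have wave_N: "wave x (N *v \<xi>) = wave (transpose N *v x) \<xi>" for x \<xi>
    using wave_transpose[of x "transpose N"] by (simp del: transpose_matrix_vector)
  have N: "map_matrix of_int M *v (transpose N *v x) = x" for x
    unfolding N_def
    by (simp add: matrix_vector_mul_assoc matrix_inv_transpose_of_int[OF assms(2)]
        del: transpose_matrix_vector)
  have tN: "(\<lambda>\<xi>. t (N *v \<xi>)) = (\<lambda>\<xi>. \<Sum>k\<in>K. h k * wave (transpose N *v real_vec k) \<xi>)"
    by (simp add: t wave_N del: transpose_matrix_vector)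
  have shift: "(\<lambda>\<xi>. t (\<xi> + dual_point M s)) =
      (\<lambda>\<xi>. \<Sum>k\<in>K. (h k * wave (real_vec k) (dual_point M s)) * wave (real_vec k) \<xi>)"
    by (simp add: t wave_shift mult_ac)
  have "\<forall>\<beta>\<in>multi_indices_below n. mixed_partial \<beta> (\<lambda>\<xi>. t (N *v \<xi>)) (real_vec s) = 0"
    using assms(1,4,5) unfolding sum_rule_def N_def by blast
  then have moments: "(\<Sum>k\<in>K. of_real (p (transpose N *v real_vec k)) *
      (h k * wave (transpose N *v real_vec k) (real_vec s))) = 0" if "i < n" "poly_le i p" for i p
    unfolding mixed_partials_zero_iff[OF tN] using that by blast
  have "(\<Sum>k\<in>K. of_real (p (real_vec k)) * (h k * wave (real_vec k) (dual_point M s))) = 0"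
    if "i < n" "poly_le i p" for i p
    using moments[OF that(1) poly_le_affine[OF that(2), of "map_matrix of_int M" 0]]
    by (simp add: N dual_point_def flip: wave_N N_def del: transpose_matrix_vector)
  then show ?thesis unfolding vanishing_moments_iff[OF shift] by blast
qed

text \<open>In the average that defines the coset part, the digit 0 contributes \<open>t\<close> divided by the number of
  digits, and all other translates vanish to order \<open>n\<close>.\<close>

lemma coset_part_moments:
  assumes "digit_set (transpose M) D" "0 \<in> D" "det M \<noteq> 0" "sum_rule M D n t" "trig_poly t"
  shows "vanishing_moments n (\<lambda>\<xi>. coset_part M D r t \<xi> - 1 / of_nat (card D) * t \<xi>)"
proof -
  have fin: "finite D" using finite_digit_set[OF assms(1)] assms(3) by simp
  have "coset_part M D r t \<xi> - 1 / of_nat (card D) * t \<xi> =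
      (\<Sum>s\<in>D - {0}. 1 / of_nat (card D) * cnj (wave (real_vec r) (dual_point M s)) * t (\<xi> + dual_point M s))" for \<xi>
    unfolding coset_part_def
    by (simp add: sum.remove[OF fin assms(2)] distrib_left sum_distrib_left mult_ac)
  moreover have "vanishing_moments n (\<lambda>\<xi>. \<Sum>s\<in>D - {0}.
      1 / of_nat (card D) * cnj (wave (real_vec r) (dual_point M s)) * t (\<xi> + dual_point M s))"
    using assms
    by (intro vanishing_moments_sum vanishing_moments_mult sum_rule_shift trig_poly_intros) auto
  ultimately show ?thesis by simp
qed

text \<open>The lattices of \<open>M\<close> and \<open>M*\<close> have the same index. Here this follows from the masks: at the
  origin each of the \<open>m\<close> coset parts equals \<open>1 / card D\<close>, while they add up to \<open>t 0 = 1\<close>.\<close>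

lemma card_digits:
  assumes "digit_set (transpose M) D" "0 \<in> D" "digit_enumeration M s"
    and "sum_rule M D n t" "refinable_mask t" "n \<ge> 1"
  shows "card D = dilation_index M"
proof -
  have t: "trig_poly t" "t 0 = 1" using assms(5) by (auto simp: refinable_mask_def)
  note det = dilation_index_pos(2)[OF assms(3)]
  have fin: "finite D" using finite_digit_set[OF assms(1)] det by simp
  \<comment> \<open>This is the moment of order 0, which is included because \<open>n\<close> is positive.\<close>
  have zero: "f 0 = 0" if "vanishing_moments n f" for f :: "real ^ 'a \<Rightarrow> complex"
  proof -
    have "mixed_partial 0 f 0 = 0"
      using that assms(6) by (simp add: vanishing_moments_def multi_indices_below_def)
    moreover have "foldr (\<lambda>i. partial i ^^ ((0 :: nat ^ 'a) $ i)) js f = f" for js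
      by (induction js) auto
    ultimately show ?thesis by (simp add: mixed_partial_def)
  qed
  have "coset_part M D (s \<nu>) t 0 = 1 / of_nat (card D)" for \<nu>
    using zero[OF coset_part_moments[OF assms(1,2) det assms(4) t(1), of "s \<nu>"]] t(2) by simp
  then have "of_nat (dilation_index M) / of_nat (card D) = (1 :: complex)"
    using sum_coset_part[OF assms(1,3) t(1), of 0] t(2) by simp
  then show ?thesis by (simp add: divide_eq_1_iff)
qed

section \<open>Symmetrization\<close>

text \<open>The first row of the unitary matrix with diagonal entries \<open>(1 + \<i>) / 2\<close> and off-diagonal entries
  \<open>(1 - \<i>) / 2\<close>; the second row is obtained by swapping the arguments. The two coefficients are
  complex conjugate, which makes the result symmetric, and they add up to 1, so that equal
  arguments are left unchanged.\<close>

definition symmetrize :: "complex \<Rightarrow> complex \<Rightarrow> complex" where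
  "symmetrize x y = (1 + \<i>) / 2 * x + (1 - \<i>) / 2 * y"

lemma symmetrize_reflect:
  assumes "x = e * cnj y" "y = e * cnj x"
  shows "symmetrize x y = e * cnj (symmetrize x y)"
proof -
  have "e * cnj (symmetrize x y) = (1 - \<i>) / 2 * (e * cnj x) + (1 + \<i>) / 2 * (e * cnj y)"
    by (simp add: symmetrize_def algebra_simps)
  also have "\<dots> = symmetrize x y"
    unfolding symmetrize_def assms(1)[symmetric] assms(2)[symmetric] by simp
  finally show ?thesis by simp
qed

lemma symmetrize_mult: "a * symmetrize x y = symmetrize (a * x) (a * y)"
  by (simp add: symmetrize_def algebra_simps)

lemma symmetrize_sum: "(\<Sum>k\<in>K. symmetrize (f k) (g k)) = symmetrize (\<Sum>k\<in>K. f k) (\<Sum>k\<in>K. g k)"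
  by (simp add: symmetrize_def sum.distrib sum_distrib_left)

lemma trig_poly_symmetrize:
  assumes "trig_poly f" "trig_poly g"
  shows "trig_poly (\<lambda>\<xi>. symmetrize (f \<xi>) (g \<xi>))"
  unfolding symmetrize_def by (intro trig_poly_intros assms)

lemma vanishing_moments_symmetrize:
  assumes "trig_poly f" "trig_poly g" "vanishing_moments n f" "vanishing_moments n g"
  shows "vanishing_moments n (\<lambda>\<xi>. symmetrize (f \<xi>) (g \<xi>))"
  unfolding symmetrize_def
  by (intro vanishing_moments_add vanishing_moments_mult trig_poly_intros assms)

lemma polyphase_components_symmetrize:
  assumes "polyphase_components M s f \<phi>" "polyphase_components M s g \<gamma>"
  shows "polyphase_components M s (\<lambda>\<xi>. symmetrize (f \<xi>) (g \<xi>)) (\<lambda>k \<xi>. symmetrize (\<phi> k \<xi>) (\<gamma> k \<xi>))"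
proof -
  have "symmetrize (f \<xi>) (g \<xi>) = 1 / of_real (sqrt (real (dilation_index M))) *
        (\<Sum>k<dilation_index M. wave (real_vec (s k)) \<xi> *
           symmetrize (\<phi> k (transpose (map_matrix of_int M) *v \<xi>)) (\<gamma> k (transpose (map_matrix of_int M) *v \<xi>)))" for \<xi>
    using assms unfolding polyphase_components_def symmetrize_mult symmetrize_sum by metis
  then show ?thesis
    using assms unfolding polyphase_components_def by (auto intro: trig_poly_symmetrize)
qed

text \<open>The squared moduli of the two coefficients are \<open>1 / 2\<close>, so the diagonal terms of \<open>\<nu>\<close> and \<open>\<sigma> \<nu>\<close> add
  up correctly. The cross terms have the coefficients \<open>\<i> / 2\<close> and \<open>- \<i> / 2\<close> and are interchanged by \<open>\<sigma>\<close>.\<close>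

lemma sum_symmetrize_involution:
  assumes "finite A" "\<And>\<nu>. \<nu> \<in> A \<Longrightarrow> \<sigma> \<nu> \<in> A" "\<And>\<nu>. \<nu> \<in> A \<Longrightarrow> \<sigma> (\<sigma> \<nu>) = \<nu>"
  shows "(\<Sum>\<nu>\<in>A. symmetrize (b \<nu>) (b (\<sigma> \<nu>)) * cnj (symmetrize (b' \<nu>) (b' (\<sigma> \<nu>)))) = (\<Sum>\<nu>\<in>A. b \<nu> * cnj (b' \<nu>))"
proof -
  have reindex: "(\<Sum>\<nu>\<in>A. f (\<sigma> \<nu>)) = (\<Sum>\<nu>\<in>A. f \<nu>)" for f :: "'a \<Rightarrow> complex"
    by (rule sum.reindex_bij_witness[of _ \<sigma> \<sigma>]) (use assms in auto)
  have "symmetrize x y * cnj (symmetrize x' y') =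
      1 / 2 * (x * cnj x') + 1 / 2 * (y * cnj y') + \<i> / 2 * (x * cnj y') - \<i> / 2 * (y * cnj x')" for x y x' y'
    by (simp add: symmetrize_def complex_eq_iff field_simps)
  then have "(\<Sum>\<nu>\<in>A. symmetrize (b \<nu>) (b (\<sigma> \<nu>)) * cnj (symmetrize (b' \<nu>) (b' (\<sigma> \<nu>)))) =
      1 / 2 * (\<Sum>\<nu>\<in>A. b \<nu> * cnj (b' \<nu>)) + 1 / 2 * (\<Sum>\<nu>\<in>A. b (\<sigma> \<nu>) * cnj (b' (\<sigma> \<nu>))) +
      \<i> / 2 * (\<Sum>\<nu>\<in>A. b \<nu> * cnj (b' (\<sigma> \<nu>))) - \<i> / 2 * (\<Sum>\<nu>\<in>A. b (\<sigma> \<nu>) * cnj (b' \<nu>))"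
    by (simp add: sum.distrib sum_subtractf sum_distrib_left)
  moreover have "(\<Sum>\<nu>\<in>A. b \<nu> * cnj (b' (\<sigma> \<nu>))) = (\<Sum>\<nu>\<in>A. b (\<sigma> \<nu>) * cnj (b' \<nu>))"
    using reindex[of "\<lambda>\<nu>. b \<nu> * cnj (b' (\<sigma> \<nu>))"] assms(3) by simp
  ultimately show ?thesis using reindex[of "\<lambda>\<nu>. b \<nu> * cnj (b' \<nu>)"] by simp
qed

section \<open>The wavelet masks\<close>

theorem theorem21:
  fixes M :: "int ^ 'd::finite ^ 'd"
    and s :: "nat \<Rightarrow> int ^ 'd"
    and D :: "(int ^ 'd) set"
    and c :: "real ^ 'd"
    and n :: nat
    and m\<^sub>0 m\<^sub>0' :: "real ^ 'd \<Rightarrow> complex"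
  assumes "matrix_dilation M"
    and "digit_enumeration M s"
    and "digit_set (transpose M) D" and "0 \<in> D"
    and "half_integral c"
    and "n \<ge> 1"
    and "refinable_mask m\<^sub>0" and "refinable_mask m\<^sub>0'"
    and "symmetric_about c m\<^sub>0" and "symmetric_about c m\<^sub>0'"
    and "sum_rule M D n m\<^sub>0"
    and "\<forall>\<beta>\<in>multi_indices_below n. mixed_partial \<beta> (\<lambda>\<xi>. 1 - m\<^sub>0 \<xi> * cnj (m\<^sub>0' \<xi>)) 0 = 0"
  shows "\<exists>w w' :: nat \<Rightarrow> real ^ 'd \<Rightarrow> complex.
    wavelet_masks M s m\<^sub>0 m\<^sub>0' w w' \<and>
    (\<forall>\<nu>\<in>{1..dilation_index M}.
       (\<exists>a. half_integral a \<and> (symmetric_about a (w \<nu>) \<or> antisymmetric_about a (w \<nu>))) \<and>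
       (\<exists>a. half_integral a \<and> (symmetric_about a (w' \<nu>) \<or> antisymmetric_about a (w' \<nu>))) \<and>
       vanishing_moments n (w' \<nu>))"
proof -
  define m where "m = dilation_index M"
  define q where "q = complex_of_real (sqrt (real m))"
  define e where "e \<nu> = wave (real_vec (s \<nu>))" for \<nu>
  define T where "T \<nu> = coset_part M D (s \<nu>) m\<^sub>0" for \<nu>
  have "m > 0" and det: "det M \<noteq> 0"
    using dilation_index_pos[OF assms(2)] by (auto simp: m_def)
  have q: "q \<noteq> 0" "q * q = of_nat m" "cnj q = q"
    using \<open>m > 0\<close> by (auto simp: q_def simp flip: of_real_mult)
  have tp: "trig_poly m\<^sub>0" "trig_poly m\<^sub>0'"
    using assms(7,8) by (auto simp: refinable_mask_def)
  have tp_T: "trig_poly (T \<nu>)" for \<nu>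
    unfolding T_def by (rule trig_poly_coset_part[OF assms(3) det tp(1)])
  have tp_e: "trig_poly (e \<nu>)" for \<nu>
    unfolding e_def by (rule trig_poly_wave)

  have "\<forall>i. \<exists>j. 2 * c $ i = of_int j"
    using assms(5) by (auto simp: half_integral_def elim: Ints_cases)
  then obtain C' where "\<And>i. 2 * c $ i = of_int (C' i)" by metis
  then have C: "2 *\<^sub>R c = real_vec (\<chi> i. C' i)" by (simp add: vec_eq_iff)
  define C where "C = (\<chi> i. C' i)"

  \<comment> \<open>The pairing of digits by the reflection \<open>k \<mapsto> 2c - k\<close> on cosets.\<close>
  have "\<forall>\<nu>. \<exists>\<nu>'. \<nu>' < m \<and> C - s \<nu> - s \<nu>' \<in> range ((*v) M)"
    using digit_enumeration_ex1[OF assms(2)] unfolding m_def by blast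
  from choice[OF this] obtain \<sigma> where \<sigma>: "\<And>\<nu>. \<sigma> \<nu> < m" "\<And>\<nu>. C - s \<nu> - s (\<sigma> \<nu>) \<in> range ((*v) M)"
    by blast
  have \<sigma>\<sigma>: "\<sigma> (\<sigma> \<nu>) = \<nu>" if "\<nu> < m" for \<nu>
  proof -
    have "C - s (\<sigma> \<nu>) - s \<nu> = C - s \<nu> - s (\<sigma> \<nu>)" by simp
    with \<sigma>(2)[of \<nu>] have "C - s (\<sigma> \<nu>) - s \<nu> \<in> range ((*v) M)" by (simp only:)
    then show ?thesis
      using digit_enumeration_ex1[OF assms(2), of "C - s (\<sigma> \<nu>)"]
        \<sigma>[of "\<sigma> \<nu>"] that unfolding m_def by blast
  qed
  have T_reflect: "T \<nu> \<xi> = wave (real_vec C) \<xi> * cnj (T (\<sigma> \<nu>) \<xi>)" for \<nu> \<xi>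
    using coset_part_symmetric[OF assms(9) C, folded C_def] coset_part_cong[OF det \<sigma>(2)]
    unfolding T_def by metis

  \<comment> \<open>The masks of the trivial factorization, before symmetrization.\<close>
  define B where "B \<nu> \<xi> = 1 / q * e \<nu> \<xi>" for \<nu> \<xi>
  define B' where "B' \<nu> \<xi> = q * e \<nu> \<xi> * (1 / of_nat m - cnj (T \<nu> \<xi>) * m\<^sub>0' \<xi>)" for \<nu> \<xi>
  have tp_B: "trig_poly (B \<nu>)" "trig_poly (B' \<nu>)" for \<nu>
    unfolding B_def B'_def by (intro trig_poly_intros tp_e tp_T tp)+
  have B_reflect: "B \<nu> \<xi> = e \<nu> \<xi> * e (\<sigma> \<nu>) \<xi> * cnj (B (\<sigma> \<nu>) \<xi>)" for \<nu> \<xi>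
    by (simp add: B_def e_def q)
  have B'_reflect: "B' \<nu> \<xi> = e \<nu> \<xi> * e (\<sigma> \<nu>) \<xi> * cnj (B' (\<sigma> \<nu>) \<xi>)" for \<nu> \<xi>
  proof -
    have "m\<^sub>0' \<xi> = wave (real_vec C) \<xi> * cnj (m\<^sub>0' \<xi>)"
      using assms(10) unfolding symmetric_about_def C C_def[symmetric] by blast
    then have "cnj (T \<nu> \<xi>) * m\<^sub>0' \<xi> =
        cnj (wave (real_vec C) \<xi> * cnj (T (\<sigma> \<nu>) \<xi>)) * (wave (real_vec C) \<xi> * cnj (m\<^sub>0' \<xi>))"
      using T_reflect[of \<nu> \<xi>] by simp
    also have "\<dots> = (wave (real_vec C) \<xi> * cnj (wave (real_vec C) \<xi>)) * (T (\<sigma> \<nu>) \<xi> * cnj (m\<^sub>0' \<xi>))"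
      by (simp only: complex_cnj_mult complex_cnj_cnj mult_ac)
    \<comment> \<open>The waves of frequency \<open>2c\<close> from the two symmetries cancel.\<close>
    finally have T: "cnj (T \<nu> \<xi>) * m\<^sub>0' \<xi> = T (\<sigma> \<nu>) \<xi> * cnj (m\<^sub>0' \<xi>)" by simp
    have "e \<nu> \<xi> * e (\<sigma> \<nu>) \<xi> * cnj (B' (\<sigma> \<nu>) \<xi>) =
        q * e \<nu> \<xi> * (e (\<sigma> \<nu>) \<xi> * cnj (e (\<sigma> \<nu>) \<xi>)) * (1 / of_nat m - T (\<sigma> \<nu>) \<xi> * cnj (m\<^sub>0' \<xi>))"
      by (simp only: B'_def q complex_cnj_mult complex_cnj_diff complex_cnj_divide complex_cnj_cnj
          complex_cnj_one complex_cnj_of_nat mult_ac)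
    also have "\<dots> = B' \<nu> \<xi>" unfolding B'_def T by (simp add: e_def)
    finally show ?thesis by simp
  qed

  have B'_moments: "vanishing_moments n (B' \<nu>)" for \<nu>
  proof -
    define g where "g \<xi> = T \<nu> \<xi> - 1 / of_nat m * m\<^sub>0 \<xi>" for \<xi>
    have g_eq: "g = (\<lambda>\<xi>. T \<nu> \<xi> - 1 / of_nat m * m\<^sub>0 \<xi>)" by (simp add: g_def fun_eq_iff)
    have "trig_poly g" unfolding g_eq by (intro trig_poly_intros tp_T tp)
    moreover have "vanishing_moments n g"
      using coset_part_moments[OF assms(3,4) det assms(11) tp(1), of "s \<nu>"]
      unfolding g_eq T_def m_def card_digits[OF assms(3,4,2,11,7,6)] .
    ultimately have g: "vanishing_moments n g" "trig_poly g" by auto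
    have "vanishing_moments n (\<lambda>\<xi>. 1 - m\<^sub>0 \<xi> * cnj (m\<^sub>0' \<xi>))"
      using assms(12) by (simp add: vanishing_moments_def)
    then have "vanishing_moments n (\<lambda>\<xi>. q * e \<nu> \<xi> *
        (1 / of_nat m * cnj (1 - m\<^sub>0 \<xi> * cnj (m\<^sub>0' \<xi>)) + (- 1) * m\<^sub>0' \<xi> * cnj (g \<xi>)))"
      by (intro vanishing_moments_mult vanishing_moments_add vanishing_moments_cnj
          trig_poly_intros tp_e tp g)
    \<comment> \<open>Here \<open>1 / m - cnj T m\<^sub>0'\<close> is split as \<open>(1 - cnj m\<^sub>0 m\<^sub>0') / m - cnj (T - m\<^sub>0 / m) m\<^sub>0'\<close>.\<close>
    also have "(\<lambda>\<xi>. q * e \<nu> \<xi> *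
        (1 / of_nat m * cnj (1 - m\<^sub>0 \<xi> * cnj (m\<^sub>0' \<xi>)) + (- 1) * m\<^sub>0' \<xi> * cnj (g \<xi>))) = B' \<nu>"
      by (simp add: B'_def g_def fun_eq_iff algebra_simps)
    finally show ?thesis .
  qed

  obtain \<tau> where \<tau>: "polyphase_components M s m\<^sub>0 \<tau>"
    and \<tau>_T: "\<And>\<nu> \<xi>. \<nu> < m \<Longrightarrow> \<tau> \<nu> (transpose (map_matrix of_int M) *v \<xi>) = q * (cnj (e \<nu> \<xi>) * T \<nu> \<xi>)"
    using polyphase_components_exist[OF assms(3,2) tp(1)] unfolding m_def q_def e_def T_def by blast
  obtain \<tau>' where \<tau>': "polyphase_components M s m\<^sub>0' \<tau>'"
    using polyphase_components_exist[OF assms(3,2) tp(2)] by blast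
  \<comment> \<open>The rows of \<open>W = I\<close> and \<open>W' = I - cnj P\<^sup>T P'\<close>.\<close>
  define \<beta> where "\<beta> \<nu> k \<xi> = (if k = \<nu> then 1 else 0 :: complex)" for \<nu> k :: nat and \<xi> :: "real ^ 'd"
  define \<beta>' where "\<beta>' \<nu> k \<xi> = \<beta> \<nu> k \<xi> - cnj (\<tau> \<nu> \<xi>) * \<tau>' k \<xi>" for \<nu> k \<xi>
  have sum_\<beta>: "(\<Sum>k<m. e k \<xi> * \<beta> \<nu> k \<eta>) = e \<nu> \<xi>" if "\<nu> < m" for \<nu> \<xi> \<eta>
    using that by (simp add: \<beta>_def if_distrib cong: if_cong)
  have tp_\<beta>: "trig_poly (\<beta> \<nu> k)" for \<nu> k
    unfolding \<beta>_def by (rule trig_poly_const)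
  have \<beta>: "polyphase_components M s (B \<nu>) (\<beta> \<nu>)" if "\<nu> < m" for \<nu>
    using sum_\<beta>[OF that]
    unfolding polyphase_components_def m_def[symmetric] q_def[symmetric] e_def[symmetric] B_def
    by (auto simp: tp_\<beta>)
  have \<beta>': "polyphase_components M s (B' \<nu>) (\<beta>' \<nu>)" if "\<nu> < m" for \<nu>
  proof -
    have "trig_poly (\<beta>' \<nu> k)" if "k < m" for k
      using \<tau> \<tau>' that \<open>\<nu> < m\<close> unfolding \<beta>'_def \<beta>_def polyphase_components_def m_def
      by (intro trig_poly_intros) auto
    moreover have "B' \<nu> \<xi> = 1 / q * (\<Sum>k<m. e k \<xi> * \<beta>' \<nu> k (transpose (map_matrix of_int M) *v \<xi>))" for \<xi>
    proof -
      let ?\<xi> = "transpose (map_matrix of_int M) *v \<xi>"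
      have m0': "m\<^sub>0' \<xi> = 1 / q * (\<Sum>k<m. e k \<xi> * \<tau>' k ?\<xi>)"
        using \<tau>' unfolding polyphase_components_def m_def q_def e_def by blast
      have "(\<Sum>k<m. e k \<xi> * \<beta>' \<nu> k ?\<xi>) = e \<nu> \<xi> - cnj (\<tau> \<nu> ?\<xi>) * (\<Sum>k<m. e k \<xi> * \<tau>' k ?\<xi>)"
        unfolding \<beta>'_def right_diff_distrib sum_subtractf sum_\<beta>[OF that] sum_distrib_left
        by (simp add: mult_ac del: transpose_matrix_vector)
      then have "1 / q * (\<Sum>k<m. e k \<xi> * \<beta>' \<nu> k ?\<xi>) = 1 / q * e \<nu> \<xi> - cnj (\<tau> \<nu> ?\<xi>) * m\<^sub>0' \<xi>"
        unfolding m0' by (simp add: right_diff_distrib mult_ac del: transpose_matrix_vector)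
      also have "\<dots> = B' \<nu> \<xi>"
        unfolding \<tau>_T[OF that] B'_def using q \<open>m > 0\<close>
        by (simp add: field_simps flip: q(2))
      finally show ?thesis by simp
    qed
    ultimately show ?thesis
      unfolding polyphase_components_def m_def q_def e_def by blast
  qed

  \<comment> \<open>Digits are numbered from 0 and wavelet masks from 1, hence the shift of the index.\<close>
  define w where "w i \<xi> = symmetrize (B (i - 1) \<xi>) (B (\<sigma> (i - 1)) \<xi>)" for i \<xi>
  define w' where "w' i \<xi> = symmetrize (B' (i - 1) \<xi>) (B' (\<sigma> (i - 1)) \<xi>)" for i \<xi>
  define \<mu> where "\<mu> i k \<xi> = (if i = 0 then \<tau> k \<xi> else symmetrize (\<beta> (i - 1) k \<xi>) (\<beta> (\<sigma> (i - 1)) k \<xi>))" for i k \<xi>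
  define \<mu>' where "\<mu>' i k \<xi> = (if i = 0 then \<tau>' k \<xi> else symmetrize (\<beta>' (i - 1) k \<xi>) (\<beta>' (\<sigma> (i - 1)) k \<xi>))" for i k \<xi>
  have row_0: "\<mu> 0 = \<tau>" "\<mu>' 0 = \<tau>'"
    by (simp_all add: \<mu>_def \<mu>'_def fun_eq_iff)
  have tp_w: "trig_poly (w i)" "trig_poly (w' i)" for i
    unfolding w_def w'_def by (intro trig_poly_symmetrize tp_B)+
  have poly_w: "polyphase_components M s (w i) (\<mu> i)" "polyphase_components M s (w' i) (\<mu>' i)"
    if "i \<in> {1..m}" for i
  proof -
    have "i - 1 < m" "i \<noteq> 0" using that by auto
    with polyphase_components_symmetrize[OF \<beta> \<beta>[OF \<sigma>(1)], of "i - 1" "i - 1"]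
      polyphase_components_symmetrize[OF \<beta>' \<beta>'[OF \<sigma>(1)], of "i - 1" "i - 1"]
    show "polyphase_components M s (w i) (\<mu> i)" "polyphase_components M s (w' i) (\<mu>' i)"
      unfolding w_def w'_def \<mu>_def \<mu>'_def by simp_all
  qed
  have identity: "(\<Sum>i\<le>m. \<mu> i k \<xi> * cnj (\<mu>' i l \<xi>)) = (if k = l then 1 else 0)"
    if "k < m" "l < m" for k l \<xi>
  proof -
    have "(\<Sum>i\<le>m. \<mu> i k \<xi> * cnj (\<mu>' i l \<xi>)) = \<tau> k \<xi> * cnj (\<tau>' l \<xi>) +
        (\<Sum>\<nu><m. symmetrize (\<beta> \<nu> k \<xi>) (\<beta> (\<sigma> \<nu>) k \<xi>) * cnj (symmetrize (\<beta>' \<nu> l \<xi>) (\<beta>' (\<sigma> \<nu>) l \<xi>)))"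
      by (simp add: sum.atMost_shift \<mu>_def \<mu>'_def)
    also have "\<dots> = \<tau> k \<xi> * cnj (\<tau>' l \<xi>) + (\<Sum>\<nu><m. \<beta> \<nu> k \<xi> * cnj (\<beta>' \<nu> l \<xi>))"
      by (subst sum_symmetrize_involution) (use \<sigma>(1) \<sigma>\<sigma> in auto)
    also have "(\<Sum>\<nu><m. \<beta> \<nu> k \<xi> * cnj (\<beta>' \<nu> l \<xi>)) = cnj (\<beta>' k l \<xi>)"
      using that by (simp add: \<beta>_def if_distrib[of "\<lambda>x. x * _"] cong: if_cong)
    finally show ?thesis by (auto simp: \<beta>'_def \<beta>_def)
  qed
  have "wavelet_masks M s m\<^sub>0 m\<^sub>0' w w'"
    unfolding wavelet_masks_def m_def[symmetric]
    by (rule conjI, use tp_w in blast, rule exI[of _ \<mu>], rule exI[of _ \<mu>'])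
      (use \<tau> \<tau>' row_0 poly_w identity in auto)
  moreover have "\<exists>a. half_integral a \<and> symmetric_about a (w i)"
    "\<exists>a. half_integral a \<and> symmetric_about a (w' i)" if "i \<in> {1..m}" for i
  proof -
    define \<nu> where "\<nu> = i - 1"
    define a where "a = (1 / 2) *\<^sub>R real_vec (s \<nu> + s (\<sigma> \<nu>))"
    have wave_a: "wave (2 *\<^sub>R a) \<xi> = e \<nu> \<xi> * e (\<sigma> \<nu>) \<xi>" for \<xi>
      by (simp add: a_def e_def wave_add)
    have "\<sigma> (\<sigma> \<nu>) = \<nu>" using \<sigma>\<sigma> that by (auto simp: \<nu>_def)
    then have "B (\<sigma> \<nu>) \<xi> = e \<nu> \<xi> * e (\<sigma> \<nu>) \<xi> * cnj (B \<nu> \<xi>)"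
      "B' (\<sigma> \<nu>) \<xi> = e \<nu> \<xi> * e (\<sigma> \<nu>) \<xi> * cnj (B' \<nu> \<xi>)" for \<xi>
      using B_reflect[of "\<sigma> \<nu>" \<xi>] B'_reflect[of "\<sigma> \<nu>" \<xi>]
      by (simp_all add: mult.commute[of "e \<nu> \<xi>"])
    then have "symmetric_about a (w i)" "symmetric_about a (w' i)"
      unfolding symmetric_about_def w_def w'_def \<nu>_def[symmetric] wave_a
      by (intro allI symmetrize_reflect B_reflect B'_reflect; simp)+
    moreover have "half_integral a" by (simp add: half_integral_def a_def add_divide_distrib)
    ultimately show "\<exists>a. half_integral a \<and> symmetric_about a (w i)"
      "\<exists>a. half_integral a \<and> symmetric_about a (w' i)" by blast+
  qed
  moreover have "vanishing_moments n (w' i)" for i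
    unfolding w'_def by (intro vanishing_moments_symmetrize tp_B B'_moments)
  ultimately show ?thesis unfolding m_def by blast
qed

end
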